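(* Let $\mathcal C$ be a balanced factorization category and $f:X\to Y$ a map in $\mathcal C$. The maps $f_{x,y}:X(x,y)\to Y(fx,fy)$ are functorial with respect to enriched composition: for all points $x,y,z:1\to X$, $$f_{x,z}\circ\mu_{x,y,z}=\mu_{fx,fy,fz}\circ(f_{x,y}\times f_{y,z}):X(x,y)\times X(y,z)\to Y(fx,fz).$$
   Context: A balanced factorization category is a finitely complete category $\mathcal C$ with two (orthogonal) factorization systems $(\mathcal E,\mathcal M)$ and $(\mathcal E',\mathcal M')$ such that $\mathcal M/1=\mathcal M'/1$ (an object $S$ has $S\to 1$ in $\mathcal M$ iff in $\mathcal M'$), and such that the pullback of a map in $\mathcal E$ along a map in $\mathcal M'$ is in $\mathcal E$, and the pullback of a map in $\mathcal E'$ along a map in $\mathcal M$ is in $\mathcal E'$. Factorizations are chosen. Internal sets are the objects $S$ with $S\to1$ in $\mathcal M$ (equivalently $\mathcal M'$); they form a reflective full subcategory $\mathcal S$ with reflection $\pi_0:\mathcal C\to\mathcal S$. A point $x:1\to X$ factors as $1\xrightarrow{e_x}X/x\xrightarrow{\downarrow x}X$ with $e_x\in\mathcal E$, $\downarrow x\in\mathcal M$ (slice), and as $1\xrightarrow{i_x}x\backslash X\xrightarrow{\uparrow x}X$ with $i_x\in\mathcal E'$, $\uparrow x\in\mathcal M'$ (coslice). $X[x,y]$ (or $[x,y]$) is the pullback of $\uparrow x:x\backslash X\to X$ and $\downarrow y:X/y\to X$, with projections $p_{x,y}:[x,y]\to x\backslash X$ and $q_{x,y}:[x,y]\to X/y$;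 $X(x,y):=\pi_0[x,y]$ with reflection map $c_{x,y}:[x,y]\to X(x,y)$. Let $i:S\to[x,y]$ be the pullback of $i_x$ along $p_{x,y}$ and $e:S'\to[x,y]$ the pullback of $e_y$ along $q_{x,y}$; then $c_{x,y}i$ and $c_{x,y}e$ are isomorphisms, and one sets $i_{x,y}:=i(c_{x,y}i)^{-1}$, $e_{x,y}:=e(c_{x,y}e)^{-1}$, both maps $X(x,y)\to[x,y]$. Enriched composition: $\mu_{x,y,z}:=c_{x,z}\circ\mu'$, where $\mu':X(x,y)\times X(y,z)\to[x,z]$ is the map into the pullback $[x,z]$ with components $p_{x,y}\circ e_{x,y}\circ\mathrm{pr}_1$ (to $x\backslash X$) and $q_{y,z}\circ i_{y,z}\circ\mathrm{pr}_2$ (to $X/z$). Action of $f:X\to Y$: $e_{f,y}:X/y\to Y/fy$ is the unique map in $\mathcal E$ with $(\downarrow fy)e_{f,y}=f(\downarrow y)$ and $e_{f,y}e_y=e_{fy}$; dually $i_{f,x}:x\backslash X\to fx\backslash Y$ is the unique map in $\mathcal E'$ with $(\uparrow fx)i_{f,x}=f(\uparrow x)$ and $i_{f,x}i_x=i_{fx}$. The map $f_{[x,y]}:X[x,y]\to Y[fx,fy]$ is induced on pullbacks by $i_{f,x}$, $e_{f,y}$ and $f$, and $f_{x,y}:=\pi_0(f_{[x,y]}):X(x,y)\to Y(fx,fy)$. *)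

theory Defs
  imports Main
begin

record ('o, 'a) cat =
  Obj :: "'o set"
  Arr :: "'a set"
  Dom :: "'a \<Rightarrow> 'o"
  Cod :: "'a \<Rightarrow> 'o"
  Id :: "'o \<Rightarrow> 'a"
  Comp :: "'a \<Rightarrow> 'a \<Rightarrow> 'a" (infixr \<open>\<cdot>\<index>\<close> 55)

definition hom :: "('o, 'a, 'r) cat_scheme \<Rightarrow> 'o \<Rightarrow> 'o \<Rightarrow> 'a set" where
  "hom C A B = {f \<in> Arr C. Dom C f = A \<and> Cod C f = B}"

text \<open>\<open>g \<cdot> f\<close> is ``\<open>g\<close> after \<open>f\<close>''; it is meaningful only if \<open>Dom g = Cod f\<close>.\<close>

locale category =
  fixes C :: "('o, 'a, 'r) cat_scheme" (structure)
  assumes dom_obj: "f \<in> Arr C \<Longrightarrow> Dom C f \<in> Obj C"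
    and cod_obj: "f \<in> Arr C \<Longrightarrow> Cod C f \<in> Obj C"
    and id_hom: "A \<in> Obj C \<Longrightarrow> Id C A \<in> hom C A A"
    and comp_hom: "\<lbrakk>f \<in> hom C X Y; g \<in> hom C Y Z\<rbrakk> \<Longrightarrow> g \<cdot> f \<in> hom C X Z"
    and comp_id_right: "f \<in> hom C X Y \<Longrightarrow> f \<cdot> Id C X = f"
    and comp_id_left: "f \<in> hom C X Y \<Longrightarrow> Id C Y \<cdot> f = f"
    and comp_assoc: "\<lbrakk>f \<in> hom C X Y; g \<in> hom C Y Z; h \<in> hom C Z W\<rbrakk>
      \<Longrightarrow> (h \<cdot> g) \<cdot> f = h \<cdot> (g \<cdot> f)"

definition inverse_arrows :: "('o, 'a, 'r) cat_scheme \<Rightarrow> 'a \<Rightarrow> 'a \<Rightarrow> bool" where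
  "inverse_arrows C f g \<longleftrightarrow> f \<in> Arr C \<and> g \<in> hom C (Cod C f) (Dom C f) \<and>
     g \<cdot>\<^bsub>C\<^esub> f = Id C (Dom C f) \<and> f \<cdot>\<^bsub>C\<^esub> g = Id C (Cod C f)"

definition is_iso :: "('o, 'a, 'r) cat_scheme \<Rightarrow> 'a \<Rightarrow> bool" where
  "is_iso C f \<longleftrightarrow> (\<exists>g. inverse_arrows C f g)"

definition inv_arrow :: "('o, 'a, 'r) cat_scheme \<Rightarrow> 'a \<Rightarrow> 'a" where
  "inv_arrow C f = (THE g. inverse_arrows C f g)"

definition is_terminal :: "('o, 'a, 'r) cat_scheme \<Rightarrow> 'o \<Rightarrow> bool" where
  "is_terminal C T \<longleftrightarrow> T \<in> Obj C \<and> (\<forall>A \<in> Obj C. \<exists>!h. h \<in> hom C A T)"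

text \<open>\<open>is_pullback C f g p q\<close>: the square \<open>f \<cdot> p = g \<cdot> q\<close> is a pullback of the cospan \<open>(f, g)\<close>.\<close>

definition is_pullback :: "('o, 'a, 'r) cat_scheme \<Rightarrow> 'a \<Rightarrow> 'a \<Rightarrow> 'a \<Rightarrow> 'a \<Rightarrow> bool" where
  "is_pullback C f g p q \<longleftrightarrow>
     f \<in> Arr C \<and> g \<in> Arr C \<and> Cod C f = Cod C g \<and>
     p \<in> hom C (Dom C p) (Dom C f) \<and> q \<in> hom C (Dom C p) (Dom C g) \<and>
     f \<cdot>\<^bsub>C\<^esub> p = g \<cdot>\<^bsub>C\<^esub> q \<and>
     (\<forall>A \<in> Obj C. \<forall>u \<in> hom C A (Dom C f). \<forall>v \<in> hom C A (Dom C g).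
        f \<cdot>\<^bsub>C\<^esub> u = g \<cdot>\<^bsub>C\<^esub> v \<longrightarrow>
        (\<exists>!h. h \<in> hom C A (Dom C p) \<and> p \<cdot>\<^bsub>C\<^esub> h = u \<and> q \<cdot>\<^bsub>C\<^esub> h = v))"

definition is_product :: "('o, 'a, 'r) cat_scheme \<Rightarrow> 'o \<Rightarrow> 'o \<Rightarrow> 'a \<Rightarrow> 'a \<Rightarrow> bool" where
  "is_product C A B p q \<longleftrightarrow>
     p \<in> hom C (Dom C p) A \<and> q \<in> hom C (Dom C p) B \<and>
     (\<forall>T \<in> Obj C. \<forall>u \<in> hom C T A. \<forall>v \<in> hom C T B.
        \<exists>!h. h \<in> hom C T (Dom C p) \<and> p \<cdot>\<^bsub>C\<^esub> h = u \<and> q \<cdot>\<^bsub>C\<^esub> h = v)"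

definition is_functor ::
    "('i, 'u, 'r) cat_scheme \<Rightarrow> ('o, 'a, 's) cat_scheme \<Rightarrow> ('i \<Rightarrow> 'o) \<Rightarrow> ('u \<Rightarrow> 'a) \<Rightarrow> bool" where
  "is_functor J C Fo Fa \<longleftrightarrow>
     (\<forall>i \<in> Obj J. Fo i \<in> Obj C \<and> Fa (Id J i) = Id C (Fo i)) \<and>
     (\<forall>u \<in> Arr J. Fa u \<in> hom C (Fo (Dom J u)) (Fo (Cod J u))) \<and>
     (\<forall>u \<in> Arr J. \<forall>v \<in> Arr J. Dom J v = Cod J u \<longrightarrow>
        Fa (v \<cdot>\<^bsub>J\<^esub> u) = Fa v \<cdot>\<^bsub>C\<^esub> Fa u)"

definition is_cone ::
    "('i, 'u, 'r) cat_scheme \<Rightarrow> ('o, 'a, 's) cat_scheme \<Rightarrow> ('i \<Rightarrow> 'o) \<Rightarrow> ('u \<Rightarrow> 'a) \<Rightarrow>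
     'o \<Rightarrow> ('i \<Rightarrow> 'a) \<Rightarrow> bool" where
  "is_cone J C Fo Fa L leg \<longleftrightarrow> L \<in> Obj C \<and>
     (\<forall>i \<in> Obj J. leg i \<in> hom C L (Fo i)) \<and>
     (\<forall>u \<in> Arr J. Fa u \<cdot>\<^bsub>C\<^esub> leg (Dom J u) = leg (Cod J u))"

definition is_limit ::
    "('i, 'u, 'r) cat_scheme \<Rightarrow> ('o, 'a, 's) cat_scheme \<Rightarrow> ('i \<Rightarrow> 'o) \<Rightarrow> ('u \<Rightarrow> 'a) \<Rightarrow>
     'o \<Rightarrow> ('i \<Rightarrow> 'a) \<Rightarrow> bool" where
  "is_limit J C Fo Fa L leg \<longleftrightarrow> is_cone J C Fo Fa L leg \<and>
     (\<forall>L' leg'. is_cone J C Fo Fa L' leg' \<longrightarrow>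
        (\<exists>!h. h \<in> hom C L' L \<and> (\<forall>i \<in> Obj J. leg i \<cdot>\<^bsub>C\<^esub> h = leg' i)))"

text \<open>Every finite category is isomorphic to one whose objects and arrows are natural
  numbers, so it suffices to quantify over index categories of that type.\<close>

definition finitely_complete :: "('o, 'a, 'r) cat_scheme \<Rightarrow> bool" where
  "finitely_complete C \<longleftrightarrow>
     (\<forall>(J :: (nat, nat) cat) Fo Fa.
        category J \<and> finite (Obj J) \<and> finite (Arr J) \<and> is_functor J C Fo Fa \<longrightarrow>
        (\<exists>L leg. is_limit J C Fo Fa L leg))"

definition factorization_system :: "('o, 'a, 'r) cat_scheme \<Rightarrow> 'a set \<Rightarrow> 'a set \<Rightarrow> bool" where
  "factorization_system C E M \<longleftrightarrow>
     E \<subseteq> Arr C \<and> M \<subseteq> Arr C \<and>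
     (\<forall>f. is_iso C f \<longrightarrow> f \<in> E \<and> f \<in> M) \<and>
     (\<forall>f \<in> E. \<forall>g \<in> E. Dom C g = Cod C f \<longrightarrow> g \<cdot>\<^bsub>C\<^esub> f \<in> E) \<and>
     (\<forall>f \<in> M. \<forall>g \<in> M. Dom C g = Cod C f \<longrightarrow> g \<cdot>\<^bsub>C\<^esub> f \<in> M) \<and>
     (\<forall>f \<in> Arr C. \<exists>e \<in> E. \<exists>m \<in> M. Dom C m = Cod C e \<and> m \<cdot>\<^bsub>C\<^esub> e = f) \<and>
     (\<forall>e \<in> E. \<forall>m \<in> M. \<forall>u \<in> hom C (Dom C e) (Dom C m). \<forall>v \<in> hom C (Cod C e) (Cod C m).
        m \<cdot>\<^bsub>C\<^esub> u = v \<cdot>\<^bsub>C\<^esub> e \<longrightarrow>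
        (\<exists>!d. d \<in> hom C (Cod C e) (Dom C m) \<and> d \<cdot>\<^bsub>C\<^esub> e = u \<and> m \<cdot>\<^bsub>C\<^esub> d = v))"

text \<open>
  A category with two pairs of classes of arrows and arbitrary choices of the universal objects
  used below: a terminal object \<open>One\<close>; the two projections \<open>Pb1 f g\<close>, \<open>Pb2 f g\<close> of a pullback of
  each cospan \<open>(f, g)\<close>; the projections \<open>Pr1 A B\<close>, \<open>Pr2 A B\<close> of each binary product; the two parts
  of a factorization \<open>f = Mfac f \<cdot> Efac f\<close> for \<open>(Ecl, Mcl)\<close> and \<open>f = Mfac' f \<cdot> Efac' f\<close> for
  \<open>(Ecl', Mcl')\<close>; and a reflection map \<open>Unit X\<close> from each object to an internal set. The chosen
  vertices are not stored, being domains or codomains of these arrows.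
\<close>

record ('o, 'a) bfc = "('o, 'a) cat" +
  One :: "'o"
  Pb1 :: "'a \<Rightarrow> 'a \<Rightarrow> 'a"
  Pb2 :: "'a \<Rightarrow> 'a \<Rightarrow> 'a"
  Pr1 :: "'o \<Rightarrow> 'o \<Rightarrow> 'a"
  Pr2 :: "'o \<Rightarrow> 'o \<Rightarrow> 'a"
  Ecl :: "'a set"
  Mcl :: "'a set"
  Ecl' :: "'a set"
  Mcl' :: "'a set"
  Efac :: "'a \<Rightarrow> 'a"
  Mfac :: "'a \<Rightarrow> 'a"
  Efac' :: "'a \<Rightarrow> 'a"
  Mfac' :: "'a \<Rightarrow> 'a"
  Unit :: "'o \<Rightarrow> 'a"

definition to_one :: "('o, 'a) bfc \<Rightarrow> 'o \<Rightarrow> 'a" where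
  "to_one B A = (THE h. h \<in> hom B A (One B))"

locale balanced_factorization_category = category B
  for B :: "('o, 'a) bfc" (structure) +
  assumes finitely_complete: "finitely_complete B"
    and terminal: "is_terminal B (One B)"
    and pullback: "\<lbrakk>f \<in> Arr B; g \<in> Arr B; Cod B f = Cod B g\<rbrakk>
      \<Longrightarrow> is_pullback B f g (Pb1 B f g) (Pb2 B f g)"
    and product: "\<lbrakk>X \<in> Obj B; Y \<in> Obj B\<rbrakk> \<Longrightarrow> is_product B X Y (Pr1 B X Y) (Pr2 B X Y)"
    and system: "factorization_system B (Ecl B) (Mcl B)"
    and system': "factorization_system B (Ecl' B) (Mcl' B)"
    and factor: "f \<in> Arr B \<Longrightarrow> Efac B f \<in> Ecl B \<and> Mfac B f \<in> Mcl B \<and>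
      Dom B (Mfac B f) = Cod B (Efac B f) \<and> Mfac B f \<cdot> Efac B f = f"
    and factor': "f \<in> Arr B \<Longrightarrow> Efac' B f \<in> Ecl' B \<and> Mfac' B f \<in> Mcl' B \<and>
      Dom B (Mfac' B f) = Cod B (Efac' B f) \<and> Mfac' B f \<cdot> Efac' B f = f"
    and same_sets: "S \<in> Obj B \<Longrightarrow> to_one B S \<in> Mcl B \<longleftrightarrow> to_one B S \<in> Mcl' B"
    and balanced: "\<lbrakk>is_pullback B f g p q; f \<in> Ecl B; g \<in> Mcl' B\<rbrakk> \<Longrightarrow> q \<in> Ecl B"
    and balanced': "\<lbrakk>is_pullback B f g p q; f \<in> Ecl' B; g \<in> Mcl B\<rbrakk> \<Longrightarrow> q \<in> Ecl' B"

definition internal_set :: "('o, 'a) bfc \<Rightarrow> 'o \<Rightarrow> bool" where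
  "internal_set B S \<longleftrightarrow> S \<in> Obj B \<and> to_one B S \<in> Mcl B"

definition is_reflection :: "('o, 'a) bfc \<Rightarrow> 'o \<Rightarrow> 'a \<Rightarrow> bool" where
  "is_reflection B X c \<longleftrightarrow> c \<in> hom B X (Cod B c) \<and> internal_set B (Cod B c) \<and>
     (\<forall>S g. internal_set B S \<and> g \<in> hom B X S \<longrightarrow>
        (\<exists>!h. h \<in> hom B (Cod B c) S \<and> h \<cdot>\<^bsub>B\<^esub> c = g))"

text \<open>The reflection onto internal sets is unique only up to isomorphism. The field \<open>Unit\<close> is
  allowed to be any choice of it; \<open>Efac\<close> and \<open>Efac'\<close> of \<open>X \<rightarrow> 1\<close> are two admissible choices.\<close>

definition chosen_reflection :: "('o, 'a) bfc \<Rightarrow> bool" where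
  "chosen_reflection B \<longleftrightarrow> (\<forall>X \<in> Obj B. is_reflection B X (Unit B X))"

context
  fixes B :: "('o, 'a) bfc" (structure)
begin

definition pb_pair :: "'a \<Rightarrow> 'a \<Rightarrow> 'a \<Rightarrow> 'a \<Rightarrow> 'a" where
  "pb_pair f g u v = (THE h. h \<in> hom B (Dom B u) (Dom B (Pb1 B f g)) \<and>
     Pb1 B f g \<cdot> h = u \<and> Pb2 B f g \<cdot> h = v)"

definition prod_obj :: "'o \<Rightarrow> 'o \<Rightarrow> 'o" where
  "prod_obj X Y = Dom B (Pr1 B X Y)"

definition prod_map :: "'a \<Rightarrow> 'a \<Rightarrow> 'a" where
  "prod_map g h = (THE k.
     k \<in> hom B (prod_obj (Dom B g) (Dom B h)) (prod_obj (Cod B g) (Cod B h)) \<and>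
     Pr1 B (Cod B g) (Cod B h) \<cdot> k = g \<cdot> Pr1 B (Dom B g) (Dom B h) \<and>
     Pr2 B (Cod B g) (Cod B h) \<cdot> k = h \<cdot> Pr2 B (Dom B g) (Dom B h))"

definition pi0 :: "'o \<Rightarrow> 'o" where
  "pi0 X = Cod B (Unit B X)"

definition pi0_map :: "'a \<Rightarrow> 'a" where
  "pi0_map g = (THE h. h \<in> hom B (pi0 (Dom B g)) (pi0 (Cod B g)) \<and>
     h \<cdot> Unit B (Dom B g) = Unit B (Cod B g) \<cdot> g)"

text \<open>For a point \<open>x : 1 \<rightarrow> X\<close>: the slice \<open>X/x\<close> with \<open>e\<^sub>x\<close> and \<open>\<down>x\<close>, and the coslice \<open>x\<setminus>X\<close>
  with \<open>i\<^sub>x\<close> and \<open>\<up>x\<close>. The object \<open>X\<close> is determined by \<open>x\<close> as its codomain.\<close>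

definition slice_pt :: "'a \<Rightarrow> 'a" where "slice_pt x = Efac B x"
definition down :: "'a \<Rightarrow> 'a" where "down x = Mfac B x"
definition slice :: "'a \<Rightarrow> 'o" where "slice x = Dom B (down x)"

definition coslice_pt :: "'a \<Rightarrow> 'a" where "coslice_pt x = Efac' B x"
definition up :: "'a \<Rightarrow> 'a" where "up x = Mfac' B x"
definition coslice :: "'a \<Rightarrow> 'o" where "coslice x = Dom B (up x)"

text \<open>\<open>bracket x y\<close> is \<open>X[x,y]\<close> and \<open>ehom x y\<close> is \<open>X(x,y) = \<pi>\<^sub>0[x,y]\<close>.\<close>

definition proj_p :: "'a \<Rightarrow> 'a \<Rightarrow> 'a" where "proj_p x y = Pb1 B (up x) (down y)"
definition proj_q :: "'a \<Rightarrow> 'a \<Rightarrow> 'a" where "proj_q x y = Pb2 B (up x) (down y)"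
definition bracket :: "'a \<Rightarrow> 'a \<Rightarrow> 'o" where "bracket x y = Dom B (proj_p x y)"
definition ehom :: "'a \<Rightarrow> 'a \<Rightarrow> 'o" where "ehom x y = pi0 (bracket x y)"
definition refl_c :: "'a \<Rightarrow> 'a \<Rightarrow> 'a" where "refl_c x y = Unit B (bracket x y)"

text \<open>\<open>i\<^sub>x\<^sub>,\<^sub>y\<close> and \<open>e\<^sub>x\<^sub>,\<^sub>y\<close>: here \<open>Pb1\<close> is the projection to \<open>[x,y]\<close>, i.e. the pullback of the
  second argument of \<open>Pb1\<close> along the first.\<close>

definition i_map :: "'a \<Rightarrow> 'a \<Rightarrow> 'a" where
  "i_map x y = (let i = Pb1 B (proj_p x y) (coslice_pt x)
     in i \<cdot> inv_arrow B (refl_c x y \<cdot> i))"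

definition e_map :: "'a \<Rightarrow> 'a \<Rightarrow> 'a" where
  "e_map x y = (let e = Pb1 B (proj_q x y) (slice_pt y)
     in e \<cdot> inv_arrow B (refl_c x y \<cdot> e))"

definition pre_mu :: "'a \<Rightarrow> 'a \<Rightarrow> 'a \<Rightarrow> 'a" where
  "pre_mu x y z = pb_pair (up x) (down z)
     (proj_p x y \<cdot> e_map x y \<cdot> Pr1 B (ehom x y) (ehom y z))
     (proj_q y z \<cdot> i_map y z \<cdot> Pr2 B (ehom x y) (ehom y z))"

definition mu :: "'a \<Rightarrow> 'a \<Rightarrow> 'a \<Rightarrow> 'a" where
  "mu x y z = refl_c x z \<cdot> pre_mu x y z"

definition slice_act :: "'a \<Rightarrow> 'a \<Rightarrow> 'a" where
  "slice_act f y = (THE g. g \<in> Ecl B \<and> g \<in> hom B (slice y) (slice (f \<cdot> y)) \<and>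
     down (f \<cdot> y) \<cdot> g = f \<cdot> down y \<and> g \<cdot> slice_pt y = slice_pt (f \<cdot> y))"

definition coslice_act :: "'a \<Rightarrow> 'a \<Rightarrow> 'a" where
  "coslice_act f x = (THE g. g \<in> Ecl' B \<and> g \<in> hom B (coslice x) (coslice (f \<cdot> x)) \<and>
     up (f \<cdot> x) \<cdot> g = f \<cdot> up x \<and> g \<cdot> coslice_pt x = coslice_pt (f \<cdot> x))"

definition bracket_act :: "'a \<Rightarrow> 'a \<Rightarrow> 'a \<Rightarrow> 'a" where
  "bracket_act f x y = pb_pair (up (f \<cdot> x)) (down (f \<cdot> y))
     (coslice_act f x \<cdot> proj_p x y) (slice_act f y \<cdot> proj_q x y)"

definition ehom_act :: "'a \<Rightarrow> 'a \<Rightarrow> 'a \<Rightarrow> 'a" where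
  "ehom_act f x y = pi0_map (bracket_act f x y)"

end

end

theory Submission
  imports Defs
begin

text \<open>The action of \<open>f\<close> on slices and coslices preserves their distinguished points, so
  \<open>f\<^bsub>[x,y]\<^esub>\<close> maps the pullbacks of \<open>i\<^sub>x\<close> and \<open>e\<^sub>y\<close> in \<open>[x,y]\<close> to the corresponding ones in
  \<open>[fx,fy]\<close>. By naturality of the reflection, the sections \<open>i\<^sub>x\<^sub>,\<^sub>y\<close> and \<open>e\<^sub>x\<^sub>,\<^sub>y\<close> of \<open>c\<^sub>x\<^sub>,\<^sub>y\<close> are then
  natural in \<open>f\<close>. Since \<open>\<mu>'\<close> is given by its two components, which are built from these
  sections, it commutes with \<open>f\<close> before reflecting, and composing with \<open>c\<^sub>x\<^sub>,\<^sub>z\<close> gives the claim.\<close>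

section \<open>Arrow calculus in a category\<close>

context category
begin

lemma homD: "f \<in> hom C A D \<Longrightarrow> f \<in> Arr C \<and> Dom C f = A \<and> Cod C f = D \<and> A \<in> Obj C \<and> D \<in> Obj C"
  using dom_obj cod_obj by (auto simp: hom_def)

text \<open>Typing is restated through \<open>Dom\<close> and \<open>Cod\<close>, with no
  intermediate object left to guess, so that these facts can act as conditional rewrite
  rules.\<close>

lemma comp_arr [simp]:
  assumes "f \<in> Arr C" "g \<in> Arr C" "Dom C g = Cod C f"
  shows "g \<cdot> f \<in> Arr C" "Dom C (g \<cdot> f) = Dom C f" "Cod C (g \<cdot> f) = Cod C g"
  using comp_hom[of f "Dom C f" "Cod C f" g "Cod C g"] assms by (auto simp: hom_def)

text \<open>Oriented towards right association, the normal form in which all the calculations below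
  are compared.\<close>

lemma comp_assoc_arr [simp]:
  assumes "f \<in> Arr C" "g \<in> Arr C" "h \<in> Arr C" "Dom C g = Cod C f" "Dom C h = Cod C g"
  shows "(h \<cdot> g) \<cdot> f = h \<cdot> g \<cdot> f"
  using assms comp_assoc[of f "Dom C f" "Cod C f" g "Cod C g" h "Cod C h"] by (auto simp: hom_def)

lemma id_arr [simp]:
  assumes "A \<in> Obj C"
  shows "Id C A \<in> Arr C" "Dom C (Id C A) = A" "Cod C (Id C A) = A"
  using id_hom[OF assms] by (auto simp: hom_def)

lemma id_right [simp]: "f \<in> Arr C \<Longrightarrow> Dom C f = A \<Longrightarrow> f \<cdot> Id C A = f"
  using comp_id_right by (auto simp: hom_def)

lemma id_left [simp]: "f \<in> Arr C \<Longrightarrow> Cod C f = A \<Longrightarrow> Id C A \<cdot> f = f"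
  using comp_id_left by (auto simp: hom_def)

section \<open>Inverses and the universal property of pullbacks\<close>

lemma inverse_inv_arrow:
  assumes "is_iso C f"
  shows "inverse_arrows C f (inv_arrow C f)"
proof -
  obtain g where g: "inverse_arrows C f g" using assms by (auto simp: is_iso_def)
  \<comment> \<open>A left inverse equals a right inverse, so the definite description in
    \<open>inv_arrow\<close> denotes.\<close>
  have "h = g" if h: "inverse_arrows C f h" for h
  proof -
    have a: "f \<in> Arr C" "g \<in> Arr C" "h \<in> Arr C" "Dom C h = Cod C f" "Cod C g = Dom C f"
      using g h by (auto simp: inverse_arrows_def hom_def)
    have "h = h \<cdot> f \<cdot> g" using g h by (simp add: inverse_arrows_def hom_def)
    also have "\<dots> = (h \<cdot> f) \<cdot> g" using a by simp
    also have "\<dots> = g" using g h by (simp add: inverse_arrows_def hom_def)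
    finally show ?thesis .
  qed
  with g show ?thesis unfolding inv_arrow_def by (rule theI)
qed

text \<open>Stability results below concern one fixed leg of a square; exchanging the legs makes
  them available for the other.\<close>

lemma is_pullback_sym:
  assumes "is_pullback C f g p q"
  shows "is_pullback C g f q p"
proof -
  have "Dom C q = Dom C p" using assms by (simp add: is_pullback_def hom_def)
  moreover have "\<exists>!h. h \<in> hom C A (Dom C p) \<and> q \<cdot> h = v \<and> p \<cdot> h = u"
    if "A \<in> Obj C" "u \<in> hom C A (Dom C f)" "v \<in> hom C A (Dom C g)" "g \<cdot> v = f \<cdot> u" for A u v
  proof -
    have "\<exists>!h. h \<in> hom C A (Dom C p) \<and> p \<cdot> h = u \<and> q \<cdot> h = v"
      using assms that unfolding is_pullback_def by simp
    then show ?thesis by (simp add: conj_commute)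
  qed
  ultimately show ?thesis
    using assms unfolding is_pullback_def by simp
qed

text \<open>Both maps are induced by the one cone with components \<open>p \<cdot> h\<close> and
  \<open>q \<cdot> h\<close>, so the projections are jointly monic.\<close>

lemma pullback_unique:
  assumes "is_pullback C f g p q" and "h \<in> hom C A (Dom C p)" and "k \<in> hom C A (Dom C p)"
    and "p \<cdot> h = p \<cdot> k" and "q \<cdot> h = q \<cdot> k"
  shows "h = k"
proof -
  have pq: "f \<in> Arr C" "g \<in> Arr C" "p \<in> Arr C" "q \<in> Arr C" "Dom C f = Cod C p" "Dom C g = Cod C q"
      "Dom C q = Dom C p" and sq: "f \<cdot> p = g \<cdot> q"
    using assms(1) by (simp_all add: is_pullback_def hom_def)
  have h: "h \<in> Arr C" "Dom C h = A" "Cod C h = Dom C p" "A \<in> Obj C"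
    using homD[OF assms(2)] by simp_all
  have "f \<cdot> p \<cdot> h = (f \<cdot> p) \<cdot> h" using pq h by simp
  also have "\<dots> = g \<cdot> q \<cdot> h" unfolding sq using pq h by simp
  finally have eq: "f \<cdot> p \<cdot> h = g \<cdot> q \<cdot> h" .
  have "p \<cdot> h \<in> hom C A (Dom C f)" "q \<cdot> h \<in> hom C A (Dom C g)"
    using pq h by (simp_all add: hom_def)
  then have "\<exists>!l. l \<in> hom C A (Dom C p) \<and> p \<cdot> l = p \<cdot> h \<and> q \<cdot> l = q \<cdot> h"
    using assms(1) h(4) eq unfolding is_pullback_def by simp
  then show ?thesis
    by (rule ex1E) (use assms(2-5) in \<open>metis (no_types)\<close>)
qed

section \<open>Orthogonal factorization systems\<close>

lemma lift:
  assumes "factorization_system C E M" and "e \<in> E" and "m \<in> M"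
    and "u \<in> hom C (Dom C e) (Dom C m)" and "v \<in> hom C (Cod C e) (Cod C m)"
    and "m \<cdot> u = v \<cdot> e"
  shows "\<exists>!d. d \<in> hom C (Cod C e) (Dom C m) \<and> d \<cdot> e = u \<and> m \<cdot> d = v"
  using assms unfolding factorization_system_def by metis

text \<open>Both arrows are diagonals of the square with top \<open>d \<cdot> e\<close> and bottom
  \<open>m \<cdot> d\<close>.\<close>

lemma lift_unique:
  assumes "factorization_system C E M" and "e \<in> E" and "m \<in> M"
    and "d \<in> hom C (Cod C e) (Dom C m)" and "d' \<in> hom C (Cod C e) (Dom C m)"
    and "d \<cdot> e = d' \<cdot> e" and "m \<cdot> d = m \<cdot> d'"
  shows "d = d'"
proof -
  have "e \<in> Arr C" "m \<in> Arr C" using assms by (auto simp: factorization_system_def)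
  then have "\<exists>!k. k \<in> hom C (Cod C e) (Dom C m) \<and> k \<cdot> e = d \<cdot> e \<and> m \<cdot> k = m \<cdot> d"
    using assms(4) by (intro lift[OF assms(1-3)]) (auto simp: hom_def)
  with assms show ?thesis by metis
qed

text \<open>Factor \<open>g = m \<cdot> n\<close>. Then \<open>g \<cdot> e\<close> factors both as
  \<open>m\<close> after \<open>n \<cdot> e\<close> and as an identity after
  \<open>g \<cdot> e\<close>, each time with first part in \<open>E\<close>. Essential uniqueness of
  factorizations makes \<open>m\<close> an isomorphism, so \<open>g\<close> lies in \<open>E\<close>
  together with \<open>n\<close>.\<close>

lemma left_class_cancel:
  assumes F: "factorization_system C E M" and e: "e \<in> E" and ge: "g \<cdot> e \<in> E"
    and g: "g \<in> Arr C" and ce: "Dom C g = Cod C e"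
  shows "g \<in> E"
proof -
  obtain n m where n: "n \<in> E" and m: "m \<in> M" and mn: "Dom C m = Cod C n" "m \<cdot> n = g"
    using F g unfolding factorization_system_def by metis
  have a [simp]: "e \<in> Arr C" "n \<in> Arr C" "m \<in> Arr C" using F e n m by (auto simp: factorization_system_def)
  have [simp]: "Dom C n = Cod C e" "Cod C g = Cod C m"
    using mn a ce comp_arr(2,3)[of n m] by simp_all
  have ne: "n \<cdot> e \<in> E" using F e n by (simp add: factorization_system_def)
  have mne: "g \<cdot> e = m \<cdot> n \<cdot> e" using mn by auto
  \<comment> \<open>The diagonal of the square from \<open>g \<cdot> e\<close> to \<open>m\<close>
    with an identity at the bottom is a right inverse of \<open>m\<close>.\<close>
  have "\<exists>!d. d \<in> hom C (Cod C (g \<cdot> e)) (Dom C m) \<and> d \<cdot> g \<cdot> e = n \<cdot> e \<and> m \<cdot> d = Id C (Cod C m)"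
    by (rule lift[OF F ge m]) (use mn g ce mne in \<open>auto simp: hom_def cod_obj\<close>)
  then obtain d where d: "d \<in> Arr C" "Dom C d = Cod C m" "Cod C d = Cod C n" "d \<cdot> g \<cdot> e = n \<cdot> e"
      "m \<cdot> d = Id C (Cod C m)"
    using g ce mn by (auto simp: hom_def)
  \<comment> \<open>Both sides are diagonals for \<open>n \<cdot> e\<close> against
    \<open>m\<close>.\<close>
  have "d \<cdot> m = Id C (Cod C n)"
  proof (rule lift_unique[OF F ne m])
    show "(d \<cdot> m) \<cdot> n \<cdot> e = Id C (Cod C n) \<cdot> n \<cdot> e"
      using d mn mne by (simp add: cod_obj)
    have "m \<cdot> d \<cdot> m = (m \<cdot> d) \<cdot> m" using d(1-3) mn(1) by simp
    also have "\<dots> = m" unfolding d(5) by simp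
    finally show "m \<cdot> d \<cdot> m = m \<cdot> Id C (Cod C n)" using mn by simp
  qed (use d mn in \<open>auto simp: hom_def cod_obj\<close>)
  then have "is_iso C m" unfolding is_iso_def inverse_arrows_def
    using d mn by (intro exI[of _ d]) (auto simp: hom_def)
  then show ?thesis using F n mn unfolding factorization_system_def by metis
qed

text \<open>The common form of the actions on slices and coslices. Orthogonality gives the unique
  fill-in, and left cancellation places it in \<open>E\<close>, so the definite descriptions in
  \<open>slice_act\<close> and \<open>coslice_act\<close>, which demand this membership, denote
  it.\<close>

lemma ex1_fill:
  assumes F: "factorization_system C E M"
    and e: "e \<in> E" "Cod C e = Dom C m" and m: "m \<in> M"
    and e': "e' \<in> E" "Cod C e' = Dom C m'" and m': "m' \<in> M"
    and f: "f \<in> Arr C" "Dom C f = Cod C m" "m' \<cdot> e' = f \<cdot> m \<cdot> e"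
  shows "\<exists>!g. g \<in> E \<and> g \<in> hom C (Dom C m) (Dom C m') \<and> m' \<cdot> g = f \<cdot> m \<and> g \<cdot> e = e'"
proof -
  have a: "e \<in> Arr C" "m \<in> Arr C" "e' \<in> Arr C" "m' \<in> Arr C"
    using F e m e' m' by (auto simp: factorization_system_def)
  have d: "Dom C e' = Dom C e" "Cod C m' = Cod C f"
    using arg_cong[OF f(3), of "Dom C"] arg_cong[OF f(3), of "Cod C"] a e(2) e'(2) f(1,2) by simp_all
  have "\<exists>!g. g \<in> hom C (Cod C e) (Dom C m') \<and> g \<cdot> e = e' \<and> m' \<cdot> g = f \<cdot> m"
    by (rule lift[OF F e(1) m']) (use a d e(2) e'(2) f in \<open>auto simp: hom_def\<close>)
  moreover have "g \<in> E" if "g \<in> hom C (Cod C e) (Dom C m')" "g \<cdot> e = e'" for g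
    by (rule left_class_cancel[OF F e(1)]) (use that e'(1) in \<open>auto simp: hom_def\<close>)
  ultimately show ?thesis unfolding e(2) by (simp add: conj_ac) blast
qed

text \<open>Factor \<open>p = m \<cdot> n\<close>. Orthogonality against \<open>g\<close> together
  with the universal property inverts \<open>n\<close>, so \<open>n\<close> lies in \<open>M\<close>
  as an isomorphism, and \<open>p\<close> is a composite of two maps in \<open>M\<close>.\<close>

lemma right_class_pullback:
  assumes F: "factorization_system C E M" and pb: "is_pullback C f g p q" and g: "g \<in> M"
  shows "p \<in> M"
proof -
  have a: "f \<in> Arr C" "g \<in> Arr C" "Cod C f = Cod C g" "p \<in> Arr C" "Cod C p = Dom C f"
      "q \<in> Arr C" "Dom C q = Dom C p" "Cod C q = Dom C g" "f \<cdot> p = g \<cdot> q"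
    using pb by (auto simp: is_pullback_def hom_def)
  obtain n m where n: "n \<in> E" and m: "m \<in> M" and mn: "Dom C m = Cod C n" "m \<cdot> n = p"
    using F a unfolding factorization_system_def by metis
  have b: "n \<in> Arr C" "m \<in> Arr C" using F n m by (auto simp: factorization_system_def)
  have c: "Dom C n = Dom C p" "Cod C m = Dom C f"
    using mn a b comp_arr(2,3)[of n m] by simp_all
  \<comment> \<open>The commuting square is \<open>f \<cdot> p = g \<cdot> q\<close> with
    \<open>p\<close> factored.\<close>
  have "\<exists>!s. s \<in> hom C (Cod C n) (Dom C g) \<and> s \<cdot> n = q \<and> g \<cdot> s = f \<cdot> m"
    by (rule lift[OF F n g]) (use a b c mn in \<open>auto simp: hom_def\<close>)
  then obtain s where s: "s \<in> hom C (Cod C n) (Dom C g)" "s \<cdot> n = q" "g \<cdot> s = f \<cdot> m" by blast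
  have "m \<in> hom C (Cod C n) (Dom C f)" using b c mn by (simp add: hom_def)
  \<comment> \<open>\<open>d\<close> is the map into the pullback with components \<open>m\<close>
    and \<open>s\<close>; it is the candidate inverse of \<open>n\<close>.\<close>
  with s obtain d where d: "d \<in> hom C (Cod C n) (Dom C p)" "p \<cdot> d = m" "q \<cdot> d = s"
    using pb homD[OF s(1)] unfolding is_pullback_def by metis
  have d': "d \<in> Arr C" "Dom C d = Cod C n" "Cod C d = Dom C p" using d by (auto simp: hom_def)
  have dn: "d \<cdot> n = Id C (Dom C p)"
  proof (rule pullback_unique[OF pb])
    have "p \<cdot> d \<cdot> n = (p \<cdot> d) \<cdot> n" using a b d' by simp
    then show "p \<cdot> d \<cdot> n = p \<cdot> Id C (Dom C p)" unfolding d(2) mn(2) using a by simp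
    have "q \<cdot> d \<cdot> n = (q \<cdot> d) \<cdot> n" using a b d' by simp
    then show "q \<cdot> d \<cdot> n = q \<cdot> Id C (Dom C p)" unfolding d(3) s(2) using a by simp
  qed (use a b c d' in \<open>auto simp: hom_def dom_obj\<close>)
  \<comment> \<open>Both sides are diagonals for \<open>n\<close> against \<open>m\<close>, since
    \<open>p \<cdot> d = m\<close>.\<close>
  have "n \<cdot> d = Id C (Cod C n)"
  proof (rule lift_unique[OF F n m])
    show "(n \<cdot> d) \<cdot> n = Id C (Cod C n) \<cdot> n" using b c d' dn by simp
    have "m \<cdot> n \<cdot> d = (m \<cdot> n) \<cdot> d" using b c d' mn(1) by simp
    then show "m \<cdot> n \<cdot> d = m \<cdot> Id C (Cod C n)" unfolding mn(2) d(2) using mn(1) b by simp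
  qed (use b c d' mn in \<open>auto simp: hom_def cod_obj\<close>)
  then have "is_iso C n" unfolding is_iso_def inverse_arrows_def
    using b c d' dn by (intro exI[of _ d]) (auto simp: hom_def)
  then have "n \<in> M" using F by (simp add: factorization_system_def)
  then show ?thesis using F m mn unfolding factorization_system_def by metis
qed

end

text \<open>\<open>i\<^sub>x\<^sub>,\<^sub>y\<close> and \<open>e\<^sub>x\<^sub>,\<^sub>y\<close> are instances of one construction, a section of \<open>c : P \<rightarrow> \<pi>\<^sub>0P\<close> obtained by
  pulling a point \<open>k\<close> back along a map \<open>p\<close> out of \<open>P\<close>.\<close>

definition refl_section :: "('o, 'a) bfc \<Rightarrow> 'a \<Rightarrow> 'a \<Rightarrow> 'a \<Rightarrow> 'a" where
  "refl_section B p k c = Pb1 B p k \<cdot>\<^bsub>B\<^esub> inv_arrow B (c \<cdot>\<^bsub>B\<^esub> Pb1 B p k)"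

section \<open>Chosen limits and the reflection onto internal sets\<close>

locale reflective_bfc = balanced_factorization_category +
  assumes reflection: "chosen_reflection B"
begin

lemma to_one_hom: "A \<in> Obj B \<Longrightarrow> to_one B A \<in> hom B A (One B)"
  using terminal theI'[of "\<lambda>h. h \<in> hom B A (One B)"] unfolding is_terminal_def to_one_def by blast

lemma one_unique: "h \<in> hom B A (One B) \<Longrightarrow> k \<in> hom B A (One B) \<Longrightarrow> h = k"
  using terminal homD[of h A "One B"] unfolding is_terminal_def by blast

lemma pullback_arr:
  assumes "f \<in> Arr B" "g \<in> Arr B" "Cod B f = Cod B g"
  shows "Pb1 B f g \<in> Arr B" "Cod B (Pb1 B f g) = Dom B f"
    "Pb2 B f g \<in> Arr B" "Dom B (Pb2 B f g) = Dom B (Pb1 B f g)" "Cod B (Pb2 B f g) = Dom B g"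
    "f \<cdot> Pb1 B f g = g \<cdot> Pb2 B f g"
  using pullback[OF assms] by (auto simp: is_pullback_def hom_def)

text \<open>Replaces the definite description by its equations once the two components form a
  commuting cone. \<open>pi0_map\<close> and \<open>prod_map\<close> are unfolded from their
  universal properties in the same way.\<close>

lemma pb_pair:
  assumes "f \<in> Arr B" "g \<in> Arr B" "Cod B f = Cod B g"
    and "u \<in> Arr B" "v \<in> Arr B" "Dom B v = Dom B u" "Cod B u = Dom B f" "Cod B v = Dom B g"
    and "f \<cdot> u = g \<cdot> v"
  shows "pb_pair B f g u v \<in> Arr B" "Dom B (pb_pair B f g u v) = Dom B u"
    "Cod B (pb_pair B f g u v) = Dom B (Pb1 B f g)"
    "Pb1 B f g \<cdot> pb_pair B f g u v = u" "Pb2 B f g \<cdot> pb_pair B f g u v = v"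
proof -
  have "\<exists>!h. h \<in> hom B (Dom B u) (Dom B (Pb1 B f g)) \<and> Pb1 B f g \<cdot> h = u \<and> Pb2 B f g \<cdot> h = v"
    using pullback[OF assms(1-3)] assms dom_obj[OF assms(4)] unfolding is_pullback_def hom_def by blast
  from theI'[OF this]
  show "pb_pair B f g u v \<in> Arr B" "Dom B (pb_pair B f g u v) = Dom B u"
    "Cod B (pb_pair B f g u v) = Dom B (Pb1 B f g)"
    "Pb1 B f g \<cdot> pb_pair B f g u v = u" "Pb2 B f g \<cdot> pb_pair B f g u v = v"
    unfolding pb_pair_def by (auto simp: hom_def)
qed

lemma unit_reflection: "X \<in> Obj B \<Longrightarrow> is_reflection B X (Unit B X)"
  using reflection by (simp add: chosen_reflection_def)

lemma unit_arr:
  assumes "X \<in> Obj B"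
  shows "Unit B X \<in> Arr B" "Dom B (Unit B X) = X" "Cod B (Unit B X) = pi0 B X"
  using unit_reflection[OF assms] by (auto simp: is_reflection_def hom_def pi0_def)

lemma pi0_map:
  assumes "g \<in> Arr B"
  shows "pi0_map B g \<in> Arr B" "Dom B (pi0_map B g) = pi0 B (Dom B g)"
    "Cod B (pi0_map B g) = pi0 B (Cod B g)"
    "pi0_map B g \<cdot> Unit B (Dom B g) = Unit B (Cod B g) \<cdot> g"
proof -
  have "internal_set B (pi0 B (Cod B g))"
    using unit_reflection[OF cod_obj[OF assms]] by (simp add: is_reflection_def pi0_def)
  moreover have "Unit B (Cod B g) \<cdot> g \<in> hom B (Dom B g) (pi0 B (Cod B g))"
    using assms unit_arr[OF cod_obj[OF assms]] by (simp add: hom_def)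
  ultimately have "\<exists>!h. h \<in> hom B (pi0 B (Dom B g)) (pi0 B (Cod B g)) \<and>
      h \<cdot> Unit B (Dom B g) = Unit B (Cod B g) \<cdot> g"
    using unit_reflection[OF dom_obj[OF assms]] unfolding is_reflection_def pi0_def by blast
  from theI'[OF this]
  show "pi0_map B g \<in> Arr B" "Dom B (pi0_map B g) = pi0 B (Dom B g)"
    "Cod B (pi0_map B g) = pi0 B (Cod B g)"
    "pi0_map B g \<cdot> Unit B (Dom B g) = Unit B (Cod B g) \<cdot> g"
    unfolding pi0_map_def by (auto simp: hom_def)
qed

lemma prod_map:
  assumes g: "g \<in> Arr B" and h: "h \<in> Arr B"
  shows "prod_map B g h \<in> Arr B"
    "Dom B (prod_map B g h) = prod_obj B (Dom B g) (Dom B h)"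
    "Cod B (prod_map B g h) = prod_obj B (Cod B g) (Cod B h)"
    "Pr1 B (Cod B g) (Cod B h) \<cdot> prod_map B g h = g \<cdot> Pr1 B (Dom B g) (Dom B h)"
    "Pr2 B (Cod B g) (Cod B h) \<cdot> prod_map B g h = h \<cdot> Pr2 B (Dom B g) (Dom B h)"
proof -
  let ?p = "Pr1 B (Dom B g) (Dom B h)" and ?q = "Pr2 B (Dom B g) (Dom B h)"
  have "is_product B (Dom B g) (Dom B h) ?p ?q"
    using g h by (intro product dom_obj)
  then have pq: "?p \<in> hom B (Dom B ?p) (Dom B g)" "?q \<in> hom B (Dom B ?p) (Dom B h)"
    by (auto simp: is_product_def)
  have "is_product B (Cod B g) (Cod B h) (Pr1 B (Cod B g) (Cod B h)) (Pr2 B (Cod B g) (Cod B h))"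
    using g h by (intro product cod_obj)
  moreover have "g \<cdot> ?p \<in> hom B (Dom B ?p) (Cod B g)" "h \<cdot> ?q \<in> hom B (Dom B ?p) (Cod B h)"
    using pq g h by (auto simp: hom_def)
  ultimately have "\<exists>!k. k \<in> hom B (prod_obj B (Dom B g) (Dom B h)) (prod_obj B (Cod B g) (Cod B h)) \<and>
     Pr1 B (Cod B g) (Cod B h) \<cdot> k = g \<cdot> Pr1 B (Dom B g) (Dom B h) \<and>
     Pr2 B (Cod B g) (Cod B h) \<cdot> k = h \<cdot> Pr2 B (Dom B g) (Dom B h)"
    using homD[OF pq(1)] unfolding is_product_def prod_obj_def by blast
  from theI'[OF this]
  show "prod_map B g h \<in> Arr B"
    "Dom B (prod_map B g h) = prod_obj B (Dom B g) (Dom B h)"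
    "Cod B (prod_map B g h) = prod_obj B (Cod B g) (Cod B h)"
    "Pr1 B (Cod B g) (Cod B h) \<cdot> prod_map B g h = g \<cdot> Pr1 B (Dom B g) (Dom B h)"
    "Pr2 B (Cod B g) (Cod B h) \<cdot> prod_map B g h = h \<cdot> Pr2 B (Dom B g) (Dom B h)"
    unfolding prod_map_def by (auto simp: hom_def)
qed

lemma pr_arr:
  assumes "X \<in> Obj B" "Y \<in> Obj B"
  shows "Pr1 B X Y \<in> Arr B" "Dom B (Pr1 B X Y) = prod_obj B X Y" "Cod B (Pr1 B X Y) = X"
    "Pr2 B X Y \<in> Arr B" "Dom B (Pr2 B X Y) = prod_obj B X Y" "Cod B (Pr2 B X Y) = Y"
  using product[OF assms] by (auto simp: is_product_def hom_def prod_obj_def)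

text \<open>Maps in \<open>E\<close> are orthogonal to internal sets, so a retraction \<open>r\<close> of \<open>i\<close> is itself a
  reflection of \<open>P\<close> and differs from \<open>c\<close> by an isomorphism.\<close>

lemma iso_reflection_comp:
  assumes F: "factorization_system B E M"
    and sets: "\<And>S. internal_set B S \<Longrightarrow> to_one B S \<in> M"
    and i: "i \<in> E" "i \<in> hom B S P" and S: "internal_set B S" and c: "is_reflection B P c"
  shows "is_iso B (c \<cdot> i)"
proof -
  \<comment> \<open>Lifting \<open>i\<close> against \<open>to_one B T\<close>: over the terminal
    object the square and the lower triangle commute automatically, which leaves unique extension
    along \<open>i\<close>.\<close>
  have ext: "\<exists>!d. d \<in> hom B P T \<and> d \<cdot> i = u" if T: "internal_set B T" and u: "u \<in> hom B S T" for T u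
  proof -
    have t: "to_one B T \<in> hom B T (One B)" "to_one B P \<in> hom B P (One B)"
      using T homD[OF i(2)] by (auto simp: internal_set_def to_one_hom)
    have "to_one B T \<cdot> u = to_one B P \<cdot> i"
      by (rule one_unique[of _ S]) (use t u i in \<open>auto simp: hom_def\<close>)
    then have "\<exists>!d. d \<in> hom B P T \<and> d \<cdot> i = u \<and> to_one B T \<cdot> d = to_one B P"
      using lift[OF F i(1) sets[OF T], of u "to_one B P"] t u i by (simp add: hom_def)
    moreover have "to_one B T \<cdot> d = to_one B P" if "d \<in> hom B P T" for d
      by (rule one_unique[of _ P]) (use t that in \<open>auto simp: hom_def\<close>)
    ultimately show ?thesis by blast
  qed
  have ext1: "d = d'"
    if T: "internal_set B T" and d: "d \<in> hom B P T" "d' \<in> hom B P T" "d \<cdot> i = d' \<cdot> i" for T d d'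
    using ext[OF T comp_hom[OF i(2) d(1)]] d by (elim ex1E) metis
  have S': "S \<in> Obj B" using S by (simp add: internal_set_def)
  obtain r where r: "r \<in> hom B P S" "r \<cdot> i = Id B S"
    using ext[OF S id_hom[OF S']] by blast
  have c': "c \<in> hom B P (Cod B c)" "internal_set B (Cod B c)"
    using c by (auto simp: is_reflection_def)
  obtain s where s: "s \<in> hom B (Cod B c) S" "s \<cdot> c = r"
    using c r S unfolding is_reflection_def by blast
  have si: "s \<cdot> c \<cdot> i = Id B S" using s r c' i by (auto simp: hom_def)
  \<comment> \<open>Two maps into the internal set \<open>Cod B c\<close> that agree along
    \<open>i\<close> are equal by \<open>ext1\<close>. Cancelling \<open>c\<close>, by uniqueness in
    its universal property, then gives the second inverse law.\<close>
  have "(c \<cdot> i \<cdot> s \<cdot> c) \<cdot> i = c \<cdot> i"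
    using s(1) c' i si S' by (simp add: hom_def)
  then have "c \<cdot> i \<cdot> s \<cdot> c = c"
    using ext1[OF c'(2), of "c \<cdot> i \<cdot> s \<cdot> c" c] c'(1) i(2) s(1) by (simp add: hom_def)
  then have "((c \<cdot> i) \<cdot> s) \<cdot> c = Id B (Cod B c) \<cdot> c"
    using c' i s by (simp add: hom_def)
  moreover have "(c \<cdot> i) \<cdot> s \<in> hom B (Cod B c) (Cod B c)" "Id B (Cod B c) \<in> hom B (Cod B c) (Cod B c)"
    using c' i s homD[OF c'(1)] by (auto simp: hom_def)
  ultimately have "(c \<cdot> i) \<cdot> s = Id B (Cod B c)"
    using c c' comp_hom[OF c'(1)] unfolding is_reflection_def by metis
  then show ?thesis
    using si c' i s unfolding is_iso_def inverse_arrows_def by (intro exI[of _ s]) (simp add: hom_def)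
qed

section \<open>Sections of the reflection over a point\<close>

lemma refl_section:
  assumes "p \<in> Arr B" "k \<in> hom B (One B) (Cod B p)" "c \<in> hom B (Dom B p) T"
    and iso: "is_iso B (c \<cdot> Pb1 B p k)"
  shows "refl_section B p k c \<in> hom B T (Dom B p)"
    "p \<cdot> refl_section B p k c = k \<cdot> to_one B T"
proof -
  let ?i = "Pb1 B p k" and ?j = "Pb2 B p k"
  define v where "v = inv_arrow B (c \<cdot> ?i)"
  have k: "k \<in> Arr B" "Dom B k = One B" "Cod B k = Cod B p" using assms by (auto simp: hom_def)
  note pb = pullback_arr[OF assms(1) k(1) k(3)[symmetric]]
  have v: "v \<in> Arr B" "Dom B v = T" "Cod B v = Dom B ?i"
    using inverse_inv_arrow[OF iso] assms pb by (auto simp: inverse_arrows_def v_def hom_def)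
  show "refl_section B p k c \<in> hom B T (Dom B p)"
    using v pb by (simp add: refl_section_def hom_def flip: v_def)
  have "p \<cdot> ?i \<cdot> v = (p \<cdot> ?i) \<cdot> v" using assms pb(1-5) v by simp
  also have "\<dots> = k \<cdot> ?j \<cdot> v" unfolding pb(6) using k pb(1-5) v by simp
  \<comment> \<open>The second projection of the pullback ends in the terminal object, so the
    section is constant at \<open>k\<close> under \<open>p\<close>.\<close>
  also have "?j \<cdot> v = to_one B T"
  proof (rule one_unique)
    show "?j \<cdot> v \<in> hom B T (One B)" using pb(1-5) v k by (simp add: hom_def)
    show "to_one B T \<in> hom B T (One B)" using homD[OF assms(3)] by (simp add: to_one_hom)
  qed
  finally show "p \<cdot> refl_section B p k c = k \<cdot> to_one B T"
    by (simp add: refl_section_def flip: v_def)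
qed

text \<open>As \<open>h\<close> carries \<open>k\<close> to \<open>k'\<close>, the map
  \<open>g\<close> restricts to a map \<open>s\<close> from the fibre of \<open>p\<close> over
  \<open>k\<close> to that of \<open>p'\<close> over \<open>k'\<close>. The reflections identify
  these fibres with \<open>T\<close> and \<open>T'\<close>, and \<open>s\<close> with
  \<open>t\<close>.\<close>

lemma refl_section_natural:
  assumes p: "p \<in> Arr B" "k \<in> hom B (One B) (Cod B p)" "c \<in> hom B (Dom B p) T"
      "is_iso B (c \<cdot> Pb1 B p k)"
    and p': "p' \<in> Arr B" "k' \<in> hom B (One B) (Cod B p')" "c' \<in> hom B (Dom B p') T'"
      "is_iso B (c' \<cdot> Pb1 B p' k')"
    and g: "g \<in> hom B (Dom B p) (Dom B p')" and h: "h \<in> hom B (Cod B p) (Cod B p')"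
    and t: "t \<in> hom B T T'"
    and sq: "p' \<cdot> g = h \<cdot> p" "h \<cdot> k = k'" "t \<cdot> c = c' \<cdot> g"
  shows "g \<cdot> refl_section B p k c = refl_section B p' k' c' \<cdot> t"
proof -
  let ?i = "Pb1 B p k" and ?i' = "Pb1 B p' k'" and ?j = "Pb2 B p k"
  define v where "v = inv_arrow B (c \<cdot> ?i)"
  define v' where "v' = inv_arrow B (c' \<cdot> ?i')"
  have k: "k \<in> Arr B" "Dom B k = One B" "Cod B k = Cod B p" using p by (auto simp: hom_def)
  have k': "k' \<in> Arr B" "Dom B k' = One B" "Cod B k' = Cod B p'" using p' by (auto simp: hom_def)
  note pb = pullback_arr[OF p(1) k(1) k(3)[symmetric]]
  note pb' = pullback_arr[OF p'(1) k'(1) k'(3)[symmetric]]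
  \<comment> \<open>Only typing facts are collected. Proper equations such as \<open>sq\<close> and
    \<open>pb(6)\<close> are unfolded where they act, because right association would break up their
    left-hand sides.\<close>
  note a = p(1,3)[unfolded hom_def] p'(1,3)[unfolded hom_def] g[unfolded hom_def]
      h[unfolded hom_def] t[unfolded hom_def] k k' pb(1-5) pb'(1-5)
  have v: "v \<in> Arr B" "Dom B v = T" "Cod B v = Dom B ?i" "(c \<cdot> ?i) \<cdot> v = Id B T"
    using inverse_inv_arrow[OF p(4)] a by (auto simp: inverse_arrows_def v_def hom_def)
  have v': "v' \<in> Arr B" "Dom B v' = T'" "Cod B v' = Dom B ?i'" "v' \<cdot> (c' \<cdot> ?i') = Id B (Dom B ?i')"
    using inverse_inv_arrow[OF p'(4)] a by (auto simp: inverse_arrows_def v'_def hom_def)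
  \<comment> \<open>Shows that \<open>g \<cdot> ?i\<close> lies over the point \<open>k'\<close>,
    hence factors through \<open>?i'\<close>.\<close>
  have "p' \<cdot> g \<cdot> ?i = (p' \<cdot> g) \<cdot> ?i" using a by simp
  also have "\<dots> = h \<cdot> p \<cdot> ?i" unfolding sq using a by simp
  also have "\<dots> = (h \<cdot> k) \<cdot> ?j" unfolding pb(6) using a by simp
  finally have "p' \<cdot> g \<cdot> ?i = k' \<cdot> ?j" by (simp add: sq)
  then have "\<exists>s. s \<in> hom B (Dom B ?i) (Dom B ?i') \<and> ?i' \<cdot> s = g \<cdot> ?i"
    using pb_pair[OF p'(1) k'(1) k'(3)[symmetric], of "g \<cdot> ?i" ?j] a by (auto simp: hom_def)
  then obtain s where s: "s \<in> Arr B" "Dom B s = Dom B ?i" "Cod B s = Dom B ?i'" "?i' \<cdot> s = g \<cdot> ?i"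
    by (auto simp: hom_def)
  have "t \<cdot> c \<cdot> ?i = (t \<cdot> c) \<cdot> ?i" using a by simp
  also have "\<dots> = c' \<cdot> ?i' \<cdot> s" unfolding sq s(4) using a by simp
  finally have tc: "t \<cdot> c \<cdot> ?i = c' \<cdot> ?i' \<cdot> s" .
  \<comment> \<open>An identity is inserted on the right so that \<open>tc\<close> applies, after
    which \<open>v'\<close> cancels \<open>c' \<cdot> ?i'\<close> on the left.\<close>
  have "v' \<cdot> t = v' \<cdot> t \<cdot> (c \<cdot> ?i) \<cdot> v" unfolding v(4) using a v' by simp
  also have "\<dots> = v' \<cdot> (t \<cdot> c \<cdot> ?i) \<cdot> v" using a v v' by simp
  also have "\<dots> = (v' \<cdot> (c' \<cdot> ?i')) \<cdot> s \<cdot> v" unfolding tc using a v(1-3) v'(1-3) s(1-3) by simp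
  also have "\<dots> = s \<cdot> v" unfolding v'(4) using a v s(1-3) by simp
  finally have "?i' \<cdot> v' \<cdot> t = (?i' \<cdot> s) \<cdot> v" using a v s(1-3) by simp
  then show ?thesis unfolding s(4) using a v v' by (simp add: refl_section_def flip: v_def v'_def)
qed

text \<open>The fibre of \<open>p\<close> over the point has its map to \<open>One B\<close> in
  \<open>M'\<close>, as a pullback of \<open>p\<close>, so it is an internal set. Its inclusion lies
  in \<open>E\<close> by balance, so \<open>iso_reflection_comp\<close> applies. Keeping both
  systems abstract lets one proof serve slices and coslices.\<close>

lemma pulled_point_iso:
  assumes F: "factorization_system B E M" and F': "factorization_system B E' M'"
    and sets: "\<And>S. S \<in> Obj B \<Longrightarrow> internal_set B S \<longleftrightarrow> to_one B S \<in> M"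
    and sets': "\<And>S. S \<in> Obj B \<Longrightarrow> internal_set B S \<longleftrightarrow> to_one B S \<in> M'"
    and bal: "\<And>f g p q. is_pullback B f g p q \<Longrightarrow> f \<in> E \<Longrightarrow> g \<in> M' \<Longrightarrow> q \<in> E"
    and p: "p \<in> M'" and k: "k \<in> E" "k \<in> hom B (One B) (Cod B p)"
    and c: "is_reflection B (Dom B p) c"
  shows "is_iso B (c \<cdot> Pb1 B p k)"
proof -
  have a: "p \<in> Arr B" using F' p by (auto simp: factorization_system_def)
  have k': "k \<in> Arr B" "Dom B k = One B" "Cod B p = Cod B k" using k(2) by (auto simp: hom_def)
  note pb = pullback[OF a k'(1,3)] and arr = pullback_arr[OF a k'(1,3)]
  have S: "Dom B (Pb1 B p k) \<in> Obj B" using arr by (simp add: dom_obj)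
  have "Pb2 B p k = to_one B (Dom B (Pb1 B p k))"
    by (rule one_unique[OF _ to_one_hom[OF S]]) (use arr k' in \<open>simp add: hom_def\<close>)
  moreover have "Pb2 B p k \<in> M'" by (rule right_class_pullback[OF F' is_pullback_sym[OF pb] p])
  ultimately have "internal_set B (Dom B (Pb1 B p k))" using sets'[OF S] by simp
  moreover have "Pb1 B p k \<in> E" using bal[OF is_pullback_sym[OF pb] k(1) p] .
  moreover have "Pb1 B p k \<in> hom B (Dom B (Pb1 B p k)) (Dom B p)" using arr by (simp add: hom_def)
  ultimately show ?thesis
    using iso_reflection_comp[OF F _ _ _ _ c] sets by (auto simp: internal_set_def)
qed

section \<open>Slices and coslices of points, and the action of a map on them\<close>

lemma slice_arr:
  assumes "x \<in> hom B (One B) X"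
  shows "slice_pt B x \<in> Ecl B" "slice_pt B x \<in> Arr B" "Dom B (slice_pt B x) = One B"
    "Cod B (slice_pt B x) = slice B x"
    "down B x \<in> Mcl B" "down B x \<in> Arr B" "Dom B (down B x) = slice B x" "Cod B (down B x) = X"
    "down B x \<cdot> slice_pt B x = x"
proof -
  have x: "x \<in> Arr B" "Dom B x = One B" "Cod B x = X" using assms by (auto simp: hom_def)
  note f = factor[OF x(1)]
  have a: "Efac B x \<in> Arr B" "Mfac B x \<in> Arr B"
    using f system by (auto simp: factorization_system_def)
  show "slice_pt B x \<in> Ecl B" "slice_pt B x \<in> Arr B" "Dom B (slice_pt B x) = One B"
    "Cod B (slice_pt B x) = slice B x"
    "down B x \<in> Mcl B" "down B x \<in> Arr B" "Dom B (down B x) = slice B x" "Cod B (down B x) = X"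
    "down B x \<cdot> slice_pt B x = x"
    using f a x comp_arr[of "Efac B x" "Mfac B x"] by (simp_all add: slice_pt_def down_def slice_def)
qed

lemma coslice_arr:
  assumes "x \<in> hom B (One B) X"
  shows "coslice_pt B x \<in> Ecl' B" "coslice_pt B x \<in> Arr B" "Dom B (coslice_pt B x) = One B"
    "Cod B (coslice_pt B x) = coslice B x"
    "up B x \<in> Mcl' B" "up B x \<in> Arr B" "Dom B (up B x) = coslice B x" "Cod B (up B x) = X"
    "up B x \<cdot> coslice_pt B x = x"
proof -
  have x: "x \<in> Arr B" "Dom B x = One B" "Cod B x = X" using assms by (auto simp: hom_def)
  note f = factor'[OF x(1)]
  have a: "Efac' B x \<in> Arr B" "Mfac' B x \<in> Arr B"
    using f system' by (auto simp: factorization_system_def)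
  show "coslice_pt B x \<in> Ecl' B" "coslice_pt B x \<in> Arr B" "Dom B (coslice_pt B x) = One B"
    "Cod B (coslice_pt B x) = coslice B x"
    "up B x \<in> Mcl' B" "up B x \<in> Arr B" "Dom B (up B x) = coslice B x" "Cod B (up B x) = X"
    "up B x \<cdot> coslice_pt B x = x"
    using f a x comp_arr[of "Efac' B x" "Mfac' B x"] by (simp_all add: coslice_pt_def up_def coslice_def)
qed

lemma slice_act:
  assumes x: "x \<in> hom B (One B) X" and f: "f \<in> hom B X Y"
  shows "slice_act B f x \<in> hom B (slice B x) (slice B (f \<cdot> x))"
    "down B (f \<cdot> x) \<cdot> slice_act B f x = f \<cdot> down B x"
    "slice_act B f x \<cdot> slice_pt B x = slice_pt B (f \<cdot> x)"
  using theI'[OF ex1_fill[OF system, of "slice_pt B x" "down B x" "slice_pt B (f \<cdot> x)" "down B (f \<cdot> x)" f]]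
    slice_arr[OF x] slice_arr[OF comp_hom[OF x f]] f
  by (auto simp: slice_act_def hom_def)

lemma coslice_act:
  assumes x: "x \<in> hom B (One B) X" and f: "f \<in> hom B X Y"
  shows "coslice_act B f x \<in> hom B (coslice B x) (coslice B (f \<cdot> x))"
    "up B (f \<cdot> x) \<cdot> coslice_act B f x = f \<cdot> up B x"
    "coslice_act B f x \<cdot> coslice_pt B x = coslice_pt B (f \<cdot> x)"
  using theI'[OF ex1_fill[OF system', of "coslice_pt B x" "up B x" "coslice_pt B (f \<cdot> x)" "up B (f \<cdot> x)" f]]
    coslice_arr[OF x] coslice_arr[OF comp_hom[OF x f]] f
  by (auto simp: coslice_act_def hom_def)

section \<open>The objects \<open>[x,y]\<close> and their reflections\<close>

lemma proj_arr:
  assumes x: "x \<in> hom B (One B) X" and y: "y \<in> hom B (One B) X"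
  shows "proj_p B x y \<in> Arr B" "Dom B (proj_p B x y) = bracket B x y" "Cod B (proj_p B x y) = coslice B x"
    "proj_q B x y \<in> Arr B" "Dom B (proj_q B x y) = bracket B x y" "Cod B (proj_q B x y) = slice B y"
    "up B x \<cdot> proj_p B x y = down B y \<cdot> proj_q B x y"
    "proj_p B x y \<in> Mcl B" "proj_q B x y \<in> Mcl' B" "bracket B x y \<in> Obj B"
proof -
  have c: "Cod B (up B x) = Cod B (down B y)" using slice_arr(8)[OF y] coslice_arr(8)[OF x] by simp
  note a = pullback_arr[OF coslice_arr(6)[OF x] slice_arr(6)[OF y] c]
  note pb = pullback[OF coslice_arr(6)[OF x] slice_arr(6)[OF y] c]
  show b: "proj_p B x y \<in> Arr B" "Dom B (proj_p B x y) = bracket B x y" "Cod B (proj_p B x y) = coslice B x"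
    "proj_q B x y \<in> Arr B" "Dom B (proj_q B x y) = bracket B x y" "Cod B (proj_q B x y) = slice B y"
    "up B x \<cdot> proj_p B x y = down B y \<cdot> proj_q B x y"
    using a slice_arr(7)[OF y] coslice_arr(7)[OF x] by (simp_all add: proj_p_def proj_q_def bracket_def)
  \<comment> \<open>Each projection inherits its class from the opposite leg of the cospan. This
    crossing is what lets balance apply to \<open>coslice_pt B x\<close> along \<open>proj_p\<close>
    and to \<open>slice_pt B y\<close> along \<open>proj_q\<close>.\<close>
  show "proj_p B x y \<in> Mcl B" unfolding proj_p_def
    by (rule right_class_pullback[OF system pb slice_arr(5)[OF y]])
  show "proj_q B x y \<in> Mcl' B" unfolding proj_q_def
    by (rule right_class_pullback[OF system' is_pullback_sym[OF pb] coslice_arr(5)[OF x]])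
  show "bracket B x y \<in> Obj B" using b(1,2) dom_obj by metis
qed

lemma bracket_pair:
  assumes x: "x \<in> hom B (One B) X" and y: "y \<in> hom B (One B) X"
    and u: "u \<in> hom B A (coslice B x)" and v: "v \<in> hom B A (slice B y)"
    and eq: "up B x \<cdot> u = down B y \<cdot> v"
  shows "pb_pair B (up B x) (down B y) u v \<in> hom B A (bracket B x y)"
    "proj_p B x y \<cdot> pb_pair B (up B x) (down B y) u v = u"
    "proj_q B x y \<cdot> pb_pair B (up B x) (down B y) u v = v"
  using pb_pair[of "up B x" "down B y" u v] u v eq slice_arr[OF y] coslice_arr[OF x]
  by (auto simp: hom_def proj_p_def proj_q_def bracket_def)

lemma bracket_ext:
  assumes x: "x \<in> hom B (One B) X" and y: "y \<in> hom B (One B) X"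
    and "h \<in> hom B A (bracket B x y)" "k \<in> hom B A (bracket B x y)"
    and "proj_p B x y \<cdot> h = proj_p B x y \<cdot> k" "proj_q B x y \<cdot> h = proj_q B x y \<cdot> k"
  shows "h = k"
  by (rule pullback_unique[OF pullback[of "up B x" "down B y"]])
    (use assms slice_arr[OF y] coslice_arr[OF x] in \<open>auto simp: proj_p_def proj_q_def bracket_def\<close>)

lemma refl_c_arr:
  assumes "x \<in> hom B (One B) X" "y \<in> hom B (One B) X"
  shows "refl_c B x y \<in> hom B (bracket B x y) (ehom B x y)"
    "is_reflection B (bracket B x y) (refl_c B x y)" "ehom B x y \<in> Obj B"
proof -
  note b = proj_arr(10)[OF assms]
  show "refl_c B x y \<in> hom B (bracket B x y) (ehom B x y)"
    using unit_arr[OF b] by (simp add: refl_c_def ehom_def hom_def)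
  then show "ehom B x y \<in> Obj B" using homD by blast
  show "is_reflection B (bracket B x y) (refl_c B x y)"
    using unit_reflection[OF b] by (simp add: refl_c_def)
qed

text \<open>Either right class detects internal sets, so \<open>pulled_point_iso\<close> can be used
  with the two systems interchanged.\<close>

lemma internal_iff: "S \<in> Obj B \<Longrightarrow> internal_set B S \<longleftrightarrow> to_one B S \<in> Mcl B"
  and internal_iff': "S \<in> Obj B \<Longrightarrow> internal_set B S \<longleftrightarrow> to_one B S \<in> Mcl' B"
  by (auto simp: internal_set_def same_sets)

section \<open>The sections \<open>i_map\<close> and \<open>e_map\<close>\<close>

lemma i_map_section:
  assumes x: "x \<in> hom B (One B) X" and y: "y \<in> hom B (One B) X"
  shows "i_map B x y = refl_section B (proj_p B x y) (coslice_pt B x) (refl_c B x y)"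
    "coslice_pt B x \<in> hom B (One B) (Cod B (proj_p B x y))"
    "refl_c B x y \<in> hom B (Dom B (proj_p B x y)) (ehom B x y)"
    "is_iso B (refl_c B x y \<cdot> Pb1 B (proj_p B x y) (coslice_pt B x))"
proof -
  show k: "coslice_pt B x \<in> hom B (One B) (Cod B (proj_p B x y))"
    using coslice_arr[OF x] proj_arr[OF x y] by (simp add: hom_def)
  \<comment> \<open>The systems enter in exchanged order: the point of the coslice lies in
    \<open>Ecl'\<close> and is pulled back along a map in \<open>Mcl\<close>.\<close>
  show "is_iso B (refl_c B x y \<cdot> Pb1 B (proj_p B x y) (coslice_pt B x))"
    by (rule pulled_point_iso[OF system' system internal_iff' internal_iff balanced' proj_arr(8)[OF x y]
        coslice_arr(1)[OF x] k]) (use proj_arr(2)[OF x y] refl_c_arr(2)[OF x y] in simp_all)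
qed (use proj_arr(2)[OF x y] refl_c_arr(1)[OF x y] in \<open>simp_all add: i_map_def refl_section_def Let_def\<close>)

lemma e_map_section:
  assumes x: "x \<in> hom B (One B) X" and y: "y \<in> hom B (One B) X"
  shows "e_map B x y = refl_section B (proj_q B x y) (slice_pt B y) (refl_c B x y)"
    "slice_pt B y \<in> hom B (One B) (Cod B (proj_q B x y))"
    "refl_c B x y \<in> hom B (Dom B (proj_q B x y)) (ehom B x y)"
    "is_iso B (refl_c B x y \<cdot> Pb1 B (proj_q B x y) (slice_pt B y))"
proof -
  show k: "slice_pt B y \<in> hom B (One B) (Cod B (proj_q B x y))"
    using slice_arr[OF y] proj_arr[OF x y] by (simp add: hom_def)
  show "is_iso B (refl_c B x y \<cdot> Pb1 B (proj_q B x y) (slice_pt B y))"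
    by (rule pulled_point_iso[OF system system' internal_iff internal_iff' balanced proj_arr(9)[OF x y]
        slice_arr(1)[OF y] k]) (use proj_arr(5)[OF x y] refl_c_arr(2)[OF x y] in simp_all)
qed (use proj_arr(5)[OF x y] refl_c_arr(1)[OF x y] in \<open>simp_all add: e_map_def refl_section_def Let_def\<close>)

lemma i_map:
  assumes x: "x \<in> hom B (One B) X" and y: "y \<in> hom B (One B) X"
  shows "i_map B x y \<in> hom B (ehom B x y) (bracket B x y)"
    "proj_p B x y \<cdot> i_map B x y = coslice_pt B x \<cdot> to_one B (ehom B x y)"
  using refl_section[OF proj_arr(1)[OF x y] i_map_section(2-4)[OF x y]] proj_arr(2)[OF x y]
  by (simp_all add: i_map_section(1)[OF x y])

lemma e_map:
  assumes x: "x \<in> hom B (One B) X" and y: "y \<in> hom B (One B) X"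
  shows "e_map B x y \<in> hom B (ehom B x y) (bracket B x y)"
    "proj_q B x y \<cdot> e_map B x y = slice_pt B y \<cdot> to_one B (ehom B x y)"
  using refl_section[OF proj_arr(4)[OF x y] e_map_section(2-4)[OF x y]] proj_arr(5)[OF x y]
  by (simp_all add: e_map_section(1)[OF x y])

section \<open>The action of \<open>f\<close> on \<open>[x,y]\<close> and on enriched homs\<close>

lemma bracket_act:
  assumes x: "x \<in> hom B (One B) X" and y: "y \<in> hom B (One B) X" and f: "f \<in> hom B X Y"
  shows "bracket_act B f x y \<in> hom B (bracket B x y) (bracket B (f \<cdot> x) (f \<cdot> y))"
    "proj_p B (f \<cdot> x) (f \<cdot> y) \<cdot> bracket_act B f x y = coslice_act B f x \<cdot> proj_p B x y"
    "proj_q B (f \<cdot> x) (f \<cdot> y) \<cdot> bracket_act B f x y = slice_act B f y \<cdot> proj_q B x y"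
proof -
  note fx = comp_hom[OF x f] and fy = comp_hom[OF y f]
  note cs = coslice_act(1)[OF x f, unfolded hom_def] and sl = slice_act(1)[OF y f, unfolded hom_def]
    and p = proj_arr(1-6)[OF x y] and f' = f[unfolded hom_def]
    and arr = coslice_arr(6-8)[OF x] coslice_arr(6-8)[OF fx] slice_arr(6-8)[OF y] slice_arr(6-8)[OF fy]
  \<comment> \<open>The two components agree over \<open>Y\<close>: both actions cover
    \<open>f\<close>, and the square defining \<open>[x,y]\<close> commutes over
    \<open>X\<close>.\<close>
  have "up B (f \<cdot> x) \<cdot> coslice_act B f x \<cdot> proj_p B x y = (up B (f \<cdot> x) \<cdot> coslice_act B f x) \<cdot> proj_p B x y"
    using cs p arr by simp
  also have "\<dots> = f \<cdot> up B x \<cdot> proj_p B x y"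
    unfolding coslice_act(2)[OF x f] using p arr f' by simp
  also have "\<dots> = (f \<cdot> down B y) \<cdot> proj_q B x y"
    unfolding proj_arr(7)[OF x y] using p arr f' by simp
  also have "\<dots> = down B (f \<cdot> y) \<cdot> slice_act B f y \<cdot> proj_q B x y"
    unfolding slice_act(2)[OF y f, symmetric] using sl p arr by simp
  finally have eq: "up B (f \<cdot> x) \<cdot> coslice_act B f x \<cdot> proj_p B x y = down B (f \<cdot> y) \<cdot> slice_act B f y \<cdot> proj_q B x y" .
  have "coslice_act B f x \<cdot> proj_p B x y \<in> hom B (bracket B x y) (coslice B (f \<cdot> x))"
    "slice_act B f y \<cdot> proj_q B x y \<in> hom B (bracket B x y) (slice B (f \<cdot> y))"
    using cs sl p by (auto simp: hom_def)
  from bracket_pair[OF fx fy this eq]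
  show "bracket_act B f x y \<in> hom B (bracket B x y) (bracket B (f \<cdot> x) (f \<cdot> y))"
    "proj_p B (f \<cdot> x) (f \<cdot> y) \<cdot> bracket_act B f x y = coslice_act B f x \<cdot> proj_p B x y"
    "proj_q B (f \<cdot> x) (f \<cdot> y) \<cdot> bracket_act B f x y = slice_act B f y \<cdot> proj_q B x y"
    by (simp_all add: bracket_act_def)
qed

lemma ehom_act:
  assumes x: "x \<in> hom B (One B) X" and y: "y \<in> hom B (One B) X" and f: "f \<in> hom B X Y"
  shows "ehom_act B f x y \<in> hom B (ehom B x y) (ehom B (f \<cdot> x) (f \<cdot> y))"
    "ehom_act B f x y \<cdot> refl_c B x y = refl_c B (f \<cdot> x) (f \<cdot> y) \<cdot> bracket_act B f x y"
proof -
  have b: "bracket_act B f x y \<in> Arr B" "Dom B (bracket_act B f x y) = bracket B x y"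
    "Cod B (bracket_act B f x y) = bracket B (f \<cdot> x) (f \<cdot> y)"
    using bracket_act(1)[OF assms] by (auto simp: hom_def)
  show "ehom_act B f x y \<in> hom B (ehom B x y) (ehom B (f \<cdot> x) (f \<cdot> y))"
    "ehom_act B f x y \<cdot> refl_c B x y = refl_c B (f \<cdot> x) (f \<cdot> y) \<cdot> bracket_act B f x y"
    using pi0_map[OF b(1)] b by (simp_all add: ehom_act_def ehom_def refl_c_def hom_def)
qed

section \<open>Naturality of the sections and of composition before reflecting\<close>

lemma i_map_natural:
  assumes x: "x \<in> hom B (One B) X" and y: "y \<in> hom B (One B) X" and f: "f \<in> hom B X Y"
  shows "bracket_act B f x y \<cdot> i_map B x y = i_map B (f \<cdot> x) (f \<cdot> y) \<cdot> ehom_act B f x y"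
proof -
  note fx = comp_hom[OF x f] and fy = comp_hom[OF y f]
  \<comment> \<open>In \<open>refl_section_natural\<close>, \<open>g\<close> is the action on
    brackets, \<open>h\<close> that on coslices and \<open>t\<close> that on enriched homs;
    \<open>h \<cdot> k = k'\<close> holds because the coslice action preserves the distinguished
    point.\<close>
  show ?thesis
    unfolding i_map_section(1)[OF x y] i_map_section(1)[OF fx fy]
    by (rule refl_section_natural[OF proj_arr(1)[OF x y] i_map_section(2-4)[OF x y]
        proj_arr(1)[OF fx fy] i_map_section(2-4)[OF fx fy] _ _ ehom_act(1)[OF x y f]
        bracket_act(2)[OF x y f] coslice_act(3)[OF x f] ehom_act(2)[OF x y f]])
      (use bracket_act(1)[OF x y f] coslice_act(1)[OF x f] proj_arr(2,3)[OF x y] proj_arr(2,3)[OF fx fy]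
        in simp_all)
qed

lemma e_map_natural:
  assumes x: "x \<in> hom B (One B) X" and y: "y \<in> hom B (One B) X" and f: "f \<in> hom B X Y"
  shows "bracket_act B f x y \<cdot> e_map B x y = e_map B (f \<cdot> x) (f \<cdot> y) \<cdot> ehom_act B f x y"
proof -
  note fx = comp_hom[OF x f] and fy = comp_hom[OF y f]
  show ?thesis
    unfolding e_map_section(1)[OF x y] e_map_section(1)[OF fx fy]
    by (rule refl_section_natural[OF proj_arr(4)[OF x y] e_map_section(2-4)[OF x y]
        proj_arr(4)[OF fx fy] e_map_section(2-4)[OF fx fy] _ _ ehom_act(1)[OF x y f]
        bracket_act(3)[OF x y f] slice_act(3)[OF y f] ehom_act(2)[OF x y f]])
      (use bracket_act(1)[OF x y f] slice_act(1)[OF y f] proj_arr(5,6)[OF x y] proj_arr(5,6)[OF fx fy]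
        in simp_all)
qed

text \<open>Both legs of the pairing become \<open>y \<cdot> !\<close> over \<open>X\<close>, so the pairing is well defined.\<close>

lemma pre_mu:
  assumes x: "x \<in> hom B (One B) X" and y: "y \<in> hom B (One B) X" and z: "z \<in> hom B (One B) X"
  shows "pre_mu B x y z \<in> hom B (prod_obj B (ehom B x y) (ehom B y z)) (bracket B x z)"
    "proj_p B x z \<cdot> pre_mu B x y z = proj_p B x y \<cdot> e_map B x y \<cdot> Pr1 B (ehom B x y) (ehom B y z)"
    "proj_q B x z \<cdot> pre_mu B x y z = proj_q B y z \<cdot> i_map B y z \<cdot> Pr2 B (ehom B x y) (ehom B y z)"
proof -
  let ?P = "prod_obj B (ehom B x y) (ehom B y z)"
  let ?l = "Pr1 B (ehom B x y) (ehom B y z)" and ?r = "Pr2 B (ehom B x y) (ehom B y z)"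
  note o1 = refl_c_arr(3)[OF x y] and o2 = refl_c_arr(3)[OF y z]
  note a = proj_arr(1-6)[OF x y] proj_arr(1-6)[OF y z] slice_arr(2-4,6-8)[OF y] slice_arr(2-4,6-8)[OF z]
    coslice_arr(2-4,6-8)[OF x] coslice_arr(2-4,6-8)[OF y]
    e_map(1)[OF x y, unfolded hom_def] i_map(1)[OF y z, unfolded hom_def] pr_arr[OF o1 o2]
    to_one_hom[OF o1, unfolded hom_def] to_one_hom[OF o2, unfolded hom_def]
  have "up B x \<cdot> proj_p B x y \<cdot> e_map B x y \<cdot> ?l = (up B x \<cdot> proj_p B x y) \<cdot> e_map B x y \<cdot> ?l"
    using a by simp
  also have "\<dots> = down B y \<cdot> (proj_q B x y \<cdot> e_map B x y) \<cdot> ?l"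
    unfolding proj_arr(7)[OF x y] using a by simp
  also have "\<dots> = (down B y \<cdot> slice_pt B y) \<cdot> to_one B (ehom B x y) \<cdot> ?l"
    unfolding e_map(2)[OF x y] using a by simp
  also have "\<dots> = (up B y \<cdot> coslice_pt B y) \<cdot> to_one B (ehom B y z) \<cdot> ?r"
  proof -
    have "to_one B (ehom B x y) \<cdot> ?l = to_one B (ehom B y z) \<cdot> ?r"
      by (rule one_unique[of _ ?P]) (use a in \<open>auto simp: hom_def\<close>)
    then show ?thesis using slice_arr(9)[OF y] coslice_arr(9)[OF y] by simp
  qed
  also have "\<dots> = up B y \<cdot> (proj_p B y z \<cdot> i_map B y z) \<cdot> ?r"
    unfolding i_map(2)[OF y z] using a by simp
  also have "\<dots> = (up B y \<cdot> proj_p B y z) \<cdot> i_map B y z \<cdot> ?r"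
    using a by simp
  also have "\<dots> = down B z \<cdot> proj_q B y z \<cdot> i_map B y z \<cdot> ?r"
    unfolding proj_arr(7)[OF y z] using a by simp
  finally have eq: "up B x \<cdot> proj_p B x y \<cdot> e_map B x y \<cdot> ?l = down B z \<cdot> proj_q B y z \<cdot> i_map B y z \<cdot> ?r" .
  have "proj_p B x y \<cdot> e_map B x y \<cdot> ?l \<in> hom B ?P (coslice B x)"
    "proj_q B y z \<cdot> i_map B y z \<cdot> ?r \<in> hom B ?P (slice B z)"
    using a by (auto simp: hom_def)
  from bracket_pair[OF x z this eq]
  show "pre_mu B x y z \<in> hom B ?P (bracket B x z)"
    "proj_p B x z \<cdot> pre_mu B x y z = proj_p B x y \<cdot> e_map B x y \<cdot> ?l"
    "proj_q B x z \<cdot> pre_mu B x y z = proj_q B y z \<cdot> i_map B y z \<cdot> ?r"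
    by (simp_all add: pre_mu_def)
qed

text \<open>Maps into \<open>[fx,fz]\<close> are compared by their projections. The first reduces to
  naturality of \<open>e_map\<close> on \<open>[x,y]\<close>, the second to that of
  \<open>i_map\<close> on \<open>[y,z]\<close>.\<close>

lemma pre_mu_natural:
  assumes x: "x \<in> hom B (One B) X" and y: "y \<in> hom B (One B) X" and z: "z \<in> hom B (One B) X"
    and f: "f \<in> hom B X Y"
  shows "bracket_act B f x z \<cdot> pre_mu B x y z =
    pre_mu B (f \<cdot> x) (f \<cdot> y) (f \<cdot> z) \<cdot> prod_map B (ehom_act B f x y) (ehom_act B f y z)"
proof -
  let ?l = "Pr1 B (ehom B x y) (ehom B y z)" and ?r = "Pr2 B (ehom B x y) (ehom B y z)"
  note fx = comp_hom[OF x f] and fy = comp_hom[OF y f] and fz = comp_hom[OF z f]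
  let ?l' = "Pr1 B (ehom B (f \<cdot> x) (f \<cdot> y)) (ehom B (f \<cdot> y) (f \<cdot> z))"
  let ?r' = "Pr2 B (ehom B (f \<cdot> x) (f \<cdot> y)) (ehom B (f \<cdot> y) (f \<cdot> z))"
  let ?m = "prod_map B (ehom_act B f x y) (ehom_act B f y z)"
  have g: "ehom_act B f x y \<in> Arr B" "Dom B (ehom_act B f x y) = ehom B x y"
      "Cod B (ehom_act B f x y) = ehom B (f \<cdot> x) (f \<cdot> y)"
    and h: "ehom_act B f y z \<in> Arr B" "Dom B (ehom_act B f y z) = ehom B y z"
      "Cod B (ehom_act B f y z) = ehom B (f \<cdot> y) (f \<cdot> z)"
    using ehom_act(1)[OF x y f] ehom_act(1)[OF y z f] by (auto simp: hom_def)
  \<comment> \<open>\<open>prod_map\<close> is typed through the domains and codomains of its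
    factors, which are rewritten here to enriched homs.\<close>
  note m = prod_map[OF g(1) h(1), unfolded g(2,3) h(2,3)]
  note a = proj_arr(1-6)[OF x y] proj_arr(1-6)[OF y z] proj_arr(1-6)[OF x z]
    proj_arr(1-6)[OF fx fy] proj_arr(1-6)[OF fy fz] proj_arr(1-6)[OF fx fz]
    e_map(1)[OF x y, unfolded hom_def] i_map(1)[OF y z, unfolded hom_def]
    e_map(1)[OF fx fy, unfolded hom_def] i_map(1)[OF fy fz, unfolded hom_def]
    pr_arr[OF refl_c_arr(3)[OF x y] refl_c_arr(3)[OF y z]]
    pr_arr[OF refl_c_arr(3)[OF fx fy] refl_c_arr(3)[OF fy fz]]
    g h m(1-3) pre_mu(1)[OF x y z, unfolded hom_def] pre_mu(1)[OF fx fy fz, unfolded hom_def]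
    bracket_act(1)[OF x z f, unfolded hom_def] bracket_act(1)[OF x y f, unfolded hom_def]
    bracket_act(1)[OF y z f, unfolded hom_def]
    coslice_act(1)[OF x f, unfolded hom_def] slice_act(1)[OF z f, unfolded hom_def]
  show ?thesis
  proof (rule bracket_ext[OF fx fz])
    show "bracket_act B f x z \<cdot> pre_mu B x y z
        \<in> hom B (prod_obj B (ehom B x y) (ehom B y z)) (bracket B (f \<cdot> x) (f \<cdot> z))"
      "pre_mu B (f \<cdot> x) (f \<cdot> y) (f \<cdot> z) \<cdot> ?m
        \<in> hom B (prod_obj B (ehom B x y) (ehom B y z)) (bracket B (f \<cdot> x) (f \<cdot> z))"
      using a by (auto simp: hom_def)
    have "proj_p B (f \<cdot> x) (f \<cdot> z) \<cdot> bracket_act B f x z \<cdot> pre_mu B x y z =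
        (proj_p B (f \<cdot> x) (f \<cdot> z) \<cdot> bracket_act B f x z) \<cdot> pre_mu B x y z"
      using a by simp
    also have "\<dots> = coslice_act B f x \<cdot> proj_p B x z \<cdot> pre_mu B x y z"
      unfolding bracket_act(2)[OF x z f] using a by simp
    also have "\<dots> = (coslice_act B f x \<cdot> proj_p B x y) \<cdot> e_map B x y \<cdot> ?l"
      unfolding pre_mu(2)[OF x y z] using a by simp
    \<comment> \<open>The coslice of \<open>x\<close> is common to \<open>[x,z]\<close> and
      \<open>[x,y]\<close>, so its action can be reabsorbed into the action on
      \<open>[x,y]\<close>.\<close>
    also have "\<dots> = proj_p B (f \<cdot> x) (f \<cdot> y) \<cdot> (bracket_act B f x y \<cdot> e_map B x y) \<cdot> ?l"
      unfolding bracket_act(2)[OF x y f, symmetric] using a by simp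
    also have "\<dots> = proj_p B (f \<cdot> x) (f \<cdot> y) \<cdot> e_map B (f \<cdot> x) (f \<cdot> y) \<cdot> ehom_act B f x y \<cdot> ?l"
      unfolding e_map_natural[OF x y f] using a by simp
    also have "\<dots> = (proj_p B (f \<cdot> x) (f \<cdot> y) \<cdot> e_map B (f \<cdot> x) (f \<cdot> y) \<cdot> ?l') \<cdot> ?m"
      unfolding m(4)[symmetric] using a by simp
    also have "\<dots> = proj_p B (f \<cdot> x) (f \<cdot> z) \<cdot> pre_mu B (f \<cdot> x) (f \<cdot> y) (f \<cdot> z) \<cdot> ?m"
      unfolding pre_mu(2)[OF fx fy fz, symmetric] using a by simp
    finally show "proj_p B (f \<cdot> x) (f \<cdot> z) \<cdot> bracket_act B f x z \<cdot> pre_mu B x y z =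
        proj_p B (f \<cdot> x) (f \<cdot> z) \<cdot> pre_mu B (f \<cdot> x) (f \<cdot> y) (f \<cdot> z) \<cdot> ?m" .
    have "proj_q B (f \<cdot> x) (f \<cdot> z) \<cdot> bracket_act B f x z \<cdot> pre_mu B x y z =
        (proj_q B (f \<cdot> x) (f \<cdot> z) \<cdot> bracket_act B f x z) \<cdot> pre_mu B x y z"
      using a by simp
    also have "\<dots> = slice_act B f z \<cdot> proj_q B x z \<cdot> pre_mu B x y z"
      unfolding bracket_act(3)[OF x z f] using a by simp
    also have "\<dots> = (slice_act B f z \<cdot> proj_q B y z) \<cdot> i_map B y z \<cdot> ?r"
      unfolding pre_mu(3)[OF x y z] using a by simp
    \<comment> \<open>Dually, \<open>[x,z]\<close> and \<open>[y,z]\<close> share the slice of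
      \<open>z\<close>.\<close>
    also have "\<dots> = proj_q B (f \<cdot> y) (f \<cdot> z) \<cdot> (bracket_act B f y z \<cdot> i_map B y z) \<cdot> ?r"
      unfolding bracket_act(3)[OF y z f, symmetric] using a by simp
    also have "\<dots> = proj_q B (f \<cdot> y) (f \<cdot> z) \<cdot> i_map B (f \<cdot> y) (f \<cdot> z) \<cdot> ehom_act B f y z \<cdot> ?r"
      unfolding i_map_natural[OF y z f] using a by simp
    also have "\<dots> = (proj_q B (f \<cdot> y) (f \<cdot> z) \<cdot> i_map B (f \<cdot> y) (f \<cdot> z) \<cdot> ?r') \<cdot> ?m"
      unfolding m(5)[symmetric] using a by simp
    also have "\<dots> = proj_q B (f \<cdot> x) (f \<cdot> z) \<cdot> pre_mu B (f \<cdot> x) (f \<cdot> y) (f \<cdot> z) \<cdot> ?m"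
      unfolding pre_mu(3)[OF fx fy fz, symmetric] using a by simp
    finally show "proj_q B (f \<cdot> x) (f \<cdot> z) \<cdot> bracket_act B f x z \<cdot> pre_mu B x y z =
        proj_q B (f \<cdot> x) (f \<cdot> z) \<cdot> pre_mu B (f \<cdot> x) (f \<cdot> y) (f \<cdot> z) \<cdot> ?m" .
  qed
qed

end

theorem proposition4p16:
  fixes B :: "('o, 'a) bfc" (structure)
  assumes "balanced_factorization_category B"
    and "chosen_reflection B"
    and "f \<in> hom B X Y"
    and "x \<in> hom B (One B) X" and "y \<in> hom B (One B) X" and "z \<in> hom B (One B) X"
  shows "ehom_act B f x z \<cdot> mu B x y z
           \<in> hom B (prod_obj B (ehom B x y) (ehom B y z)) (ehom B (f \<cdot> x) (f \<cdot> z))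
       \<and> ehom_act B f x z \<cdot> mu B x y z
           = mu B (f \<cdot> x) (f \<cdot> y) (f \<cdot> z) \<cdot> prod_map B (ehom_act B f x y) (ehom_act B f y z)"
proof -
  interpret reflective_bfc B
    using assms(1,2) by (simp add: reflective_bfc_def reflective_bfc_axioms_def)
  note f = assms(3) and x = assms(4) and y = assms(5) and z = assms(6)
  note fx = comp_hom[OF x f] and fy = comp_hom[OF y f] and fz = comp_hom[OF z f]
  have g: "ehom_act B f x y \<in> Arr B" "Dom B (ehom_act B f x y) = ehom B x y"
      "Cod B (ehom_act B f x y) = ehom B (f \<cdot> x) (f \<cdot> y)"
    and h: "ehom_act B f y z \<in> Arr B" "Dom B (ehom_act B f y z) = ehom B y z"
      "Cod B (ehom_act B f y z) = ehom B (f \<cdot> y) (f \<cdot> z)"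
    using ehom_act(1)[OF x y f] ehom_act(1)[OF y z f] by (auto simp: hom_def)
  note a = ehom_act(1)[OF x z f, unfolded hom_def] refl_c_arr(1)[OF x z, unfolded hom_def]
    refl_c_arr(1)[OF fx fz, unfolded hom_def] bracket_act(1)[OF x z f, unfolded hom_def]
    pre_mu(1)[OF x y z, unfolded hom_def] pre_mu(1)[OF fx fy fz, unfolded hom_def]
    prod_map(1-3)[OF g(1) h(1), unfolded g(2,3) h(2,3)]
  have "ehom_act B f x z \<cdot> mu B x y z = (ehom_act B f x z \<cdot> refl_c B x z) \<cdot> pre_mu B x y z"
    unfolding mu_def using a by simp
  \<comment> \<open>Naturality of the reflection moves \<open>f\<close> inside
    \<open>refl_c\<close>, which leaves the identity \<open>pre_mu_natural\<close>.\<close>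
  also have "\<dots> = refl_c B (f \<cdot> x) (f \<cdot> z) \<cdot> bracket_act B f x z \<cdot> pre_mu B x y z"
    unfolding ehom_act(2)[OF x z f] using a by simp
  also have "\<dots> = mu B (f \<cdot> x) (f \<cdot> y) (f \<cdot> z) \<cdot> prod_map B (ehom_act B f x y) (ehom_act B f y z)"
    unfolding pre_mu_natural[OF x y z f] mu_def using a by simp
  finally show ?thesis
    using a by (auto simp: mu_def hom_def)
qed

end
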